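(* Let $X$ be a metric space. Assume that for every $\epsilon>0$ there exist some $\delta>0$, a metric space $W$, and a mapping $\Phi\colon X\to W$ such that $\Phi[X]$ is totally bounded and such that, whenever $x,y\in X$ satisfy $d(\Phi(x),\Phi(y))<\delta$, one has $d(x,y)<\epsilon$. Then $X$ is totally bounded.
   Context: Every metric is denoted $d$. An $\epsilon$-cover of a metric space is a cover of the space consisting of sets of diameter at most $\epsilon$. A metric space is called totally bounded if it admits a finite $\epsilon$-cover for every $\epsilon>0$; a subset of a metric space is totally bounded if it is so with the induced metric. The mapping $\Phi$ is not assumed continuous, and $\delta$, $W$, $\Phi$ may depend on $\epsilon$. *)

theory Defs
  imports "HOL-Analysis.Abstract_Metric_Spaces" "HOL-Library.Extended_Nonnegative_Real"
begin

text \<open>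
  A metric space is a carrier set together with a distance function satisfying
  \<^locale>\<open>Metric_space\<close>. Since the distance on a subset is the same function, the subset
  \<open>S\<close> of a space \<open>(M, d)\<close> with the induced metric is the pair \<open>(S, d)\<close>.

  The diameter takes values in the extended nonnegative reals, so that unbounded sets have
  diameter \<open>\<infinity>\<close> and the empty set has diameter \<open>0\<close>.
\<close>

definition metric_diameter :: "('a \<Rightarrow> 'a \<Rightarrow> real) \<Rightarrow> 'a set \<Rightarrow> ennreal" where
  "metric_diameter d A = (SUP (x, y) \<in> A \<times> A. ennreal (d x y))"

definition eps_cover :: "'a set \<Rightarrow> ('a \<Rightarrow> 'a \<Rightarrow> real) \<Rightarrow> real \<Rightarrow> 'a set set \<Rightarrow> bool" where
  "eps_cover M d \<epsilon> \<C> \<longleftrightarrow>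
     \<Union>\<C> = M \<and> (\<forall>A\<in>\<C>. metric_diameter d A \<le> ennreal \<epsilon>)"

definition metric_totally_bounded :: "'a set \<Rightarrow> ('a \<Rightarrow> 'a \<Rightarrow> real) \<Rightarrow> bool" where
  "metric_totally_bounded M d \<longleftrightarrow> (\<forall>\<epsilon>>0. \<exists>\<C>. finite \<C> \<and> eps_cover M d \<epsilon> \<C>)"

lemma metric_diameter_le_iff:
  assumes "\<epsilon> \<ge> 0"
  shows "metric_diameter d A \<le> ennreal \<epsilon> \<longleftrightarrow> (\<forall>x\<in>A. \<forall>y\<in>A. d x y \<le> \<epsilon>)"
  using assms by (auto simp: metric_diameter_def SUP_le_iff ennreal_le_iff2)

text \<open>
  The library's notion, which covers by balls centred in the set, agrees with the one above.
\<close>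

lemma (in Metric_space) mtotally_bounded_iff_metric_totally_bounded:
  assumes "S \<subseteq> M"
  shows "mtotally_bounded S \<longleftrightarrow> metric_totally_bounded S d"
proof
  assume L: "mtotally_bounded S"
  show "metric_totally_bounded S d"
    unfolding metric_totally_bounded_def
  proof (intro allI impI)
    fix \<epsilon> :: real assume e: "\<epsilon> > 0"
    then obtain K where K: "finite K" "K \<subseteq> S" "S \<subseteq> (\<Union>x\<in>K. mball x (\<epsilon>/2))"
      using L unfolding mtotally_bounded_def by (meson half_gt_zero)
    have D: "d x y \<le> \<epsilon>" if "x \<in> mball a (\<epsilon>/2)" "y \<in> mball a (\<epsilon>/2)" for x y a
      using that triangle''[of x a y] by (auto simp: commute)
    have "eps_cover S d \<epsilon> ((\<lambda>x. mball x (\<epsilon>/2) \<inter> S) ` K)"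
      using K(3) e D by (auto simp: eps_cover_def metric_diameter_le_iff simp del: in_mball)
    with K(1) show "\<exists>\<C>. finite \<C> \<and> eps_cover S d \<epsilon> \<C>" by blast
  qed
next
  assume R: "metric_totally_bounded S d"
  show "mtotally_bounded S"
    unfolding mtotally_bounded_def
  proof (intro allI impI)
    fix \<epsilon> :: real assume e: "\<epsilon> > 0"
    then obtain \<C> where C: "finite \<C>" "eps_cover S d (\<epsilon>/2) \<C>"
      using R unfolding metric_totally_bounded_def by (meson half_gt_zero)
    define K where "K = (\<lambda>A. SOME x. x \<in> A) ` (\<C> - {{}})"
    have pick: "(SOME x. x \<in> A) \<in> A" if "A \<in> \<C> - {{}}" for A
      using that by (metis Diff_iff all_not_in_conv insert_iff someI_ex)
    have U: "\<Union>\<C> = S" and D: "\<And>A x y. A \<in> \<C> \<Longrightarrow> x \<in> A \<Longrightarrow> y \<in> A \<Longrightarrow> d x y \<le> \<epsilon>/2"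
      using C(2) e by (auto simp: eps_cover_def metric_diameter_le_iff)
    have KS: "K \<subseteq> S" using pick U unfolding K_def by blast
    have "S \<subseteq> (\<Union>x\<in>K. mball x \<epsilon>)"
    proof
      fix y assume y: "y \<in> S"
      then obtain A where A: "A \<in> \<C>" "y \<in> A" using U by blast
      define x where "x = (SOME x. x \<in> A)"
      have x: "x \<in> A" "x \<in> K" using pick[of A] A unfolding K_def x_def by auto
      then have "d x y < \<epsilon>" using D[of A x y] A e by auto
      moreover have "x \<in> M" "y \<in> M" using x KS y assms by auto
      ultimately show "y \<in> (\<Union>x\<in>K. mball x \<epsilon>)" using x by auto
    qed
    moreover have "finite K" using C(1) by (simp add: K_def)
    ultimately show "\<exists>K. finite K \<and> K \<subseteq> S \<and> S \<subseteq> (\<Union>x\<in>K. mball x \<epsilon>)" using KS by blast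
  qed
qed

end

theory Submission
  imports Defs
begin

text \<open>Total boundedness is pulled back along \<Phi>. Take a finite cover of \<Phi>[X] by sets
  so small that any two points of one set are closer than \<delta>. Two points of X whose images lie
  in the same set are then closer than \<epsilon>, so the preimages of these sets form a finite
  \<epsilon>-cover of X.\<close>

theorem lemma1:
  fixes X :: "'a set" and d :: "'a \<Rightarrow> 'a \<Rightarrow> real"
  assumes "Metric_space X d"
    and "\<And>\<epsilon>::real. \<epsilon> > 0 \<Longrightarrow>
           \<exists>\<delta>>0. \<exists>(W :: 'w set) (dW :: 'w \<Rightarrow> 'w \<Rightarrow> real) (\<Phi> :: 'a \<Rightarrow> 'w).
             Metric_space W dW \<and> \<Phi> \<in> X \<rightarrow> W \<and>
             metric_totally_bounded (\<Phi> ` X) dW \<and>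
             (\<forall>x\<in>X. \<forall>y\<in>X. dW (\<Phi> x) (\<Phi> y) < \<delta> \<longrightarrow> d x y < \<epsilon>)"
  shows "metric_totally_bounded X d"
  unfolding metric_totally_bounded_def
proof (intro allI impI)
  fix \<epsilon> :: real assume e: "\<epsilon> > 0"
  from assms(2)[OF e] obtain \<delta> and dW :: "'w \<Rightarrow> 'w \<Rightarrow> real" and \<Phi> :: "'a \<Rightarrow> 'w"
    where \<delta>: "\<delta> > 0" and tb: "metric_totally_bounded (\<Phi> ` X) dW"
      and \<Phi>: "\<And>x y. x \<in> X \<Longrightarrow> y \<in> X \<Longrightarrow> dW (\<Phi> x) (\<Phi> y) < \<delta> \<Longrightarrow> d x y < \<epsilon>"
    by blast
  \<comment> \<open>A diameter bound is only a non-strict inequality, whereas \<Phi> needs distances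
    strictly below \<delta>; halving \<delta> bridges the gap.\<close>
  from tb \<delta> obtain \<C> where fin: "finite \<C>" and cov: "eps_cover (\<Phi> ` X) dW (\<delta>/2) \<C>"
    unfolding metric_totally_bounded_def by (meson half_gt_zero)
  have U: "\<Union>\<C> = \<Phi> ` X"
    and D: "\<And>A u v. A \<in> \<C> \<Longrightarrow> u \<in> A \<Longrightarrow> v \<in> A \<Longrightarrow> dW u v \<le> \<delta>/2"
    using cov \<delta> by (auto simp: eps_cover_def metric_diameter_le_iff)
  \<comment> \<open>\<open>\<Phi>\<close> is total on the type \<open>'a\<close>, so a preimage may
    contain points outside \<open>X\<close>; hence the intersection with \<open>X\<close>.\<close>
  have "d x y \<le> \<epsilon>" if "A \<in> \<C>" "x \<in> \<Phi> -` A \<inter> X" "y \<in> \<Phi> -` A \<inter> X" for A x y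
  proof -
    have "dW (\<Phi> x) (\<Phi> y) \<le> \<delta>/2"
      using D that by blast
    with \<Phi>[of x y] that \<delta> show ?thesis by simp
  qed
  moreover have "(\<Union>A\<in>\<C>. \<Phi> -` A \<inter> X) = \<Phi> -` \<Union>\<C> \<inter> X"
    by auto
  then have "(\<Union>A\<in>\<C>. \<Phi> -` A \<inter> X) = X"
    unfolding U by auto
  ultimately have "eps_cover X d \<epsilon> ((\<lambda>A. \<Phi> -` A \<inter> X) ` \<C>)"
    using e by (simp add: eps_cover_def metric_diameter_le_iff)
  with fin show "\<exists>\<C>. finite \<C> \<and> eps_cover X d \<epsilon> \<C>"
    by (intro exI[where x = "(\<lambda>A. \<Phi> -` A \<inter> X) ` \<C>"]) simp
qed

end
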